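(* Let $\mathcal{A}$ be an (additive) Abelian group and $a_1,\dots,a_n\in\mathcal{A}$. A function $f:\mathcal{A}\to\mathbb{R}$ decomposes into a sum $f=f_1+\cdots+f_n$ of functions $f_j:\mathcal{A}\to\mathbb{R}$ with $f_j$ being $a_j$-periodic for each $j=1,\dots,n$, if and only if for all partitions $B_1\cup B_2\cup\cdots\cup B_N=\{a_1,\dots,a_n\}$ and for any elements $b_j\in[B_j]$, $j=1,\dots,N$, one has $$\Delta_{b_1}\cdots\Delta_{b_N}f=0.$$
   Context: For $a\in\mathcal{A}$ and a function $f$ on $\mathcal{A}$, $\Delta_a f(x):=f(x+a)-f(x)$; $f$ is $a$-periodic if $\Delta_a f=0$. For a nonempty finite set $B=\{c_1,\dots,c_k\}\subseteq\mathcal{A}$, $[B]:=\bigcap_{i=1}^k\langle c_i\rangle$, where $\langle c_i\rangle$ is the cyclic subgroup of $\mathcal{A}$ generated by $c_i$. Partitions are partitions of the set $\{a_1,\dots,a_n\}$ into nonempty blocks. *)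

theory Defs
  imports
    Complex_Main
    "HOL-Library.Disjoint_Sets"
    "HOL-Computational_Algebra.Group_Closure"
begin

definition diff_op :: "'a::ab_group_add \<Rightarrow> ('a \<Rightarrow> real) \<Rightarrow> 'a \<Rightarrow> real" where
  "diff_op a f = (\<lambda>x. f (x + a) - f x)"

definition periodic :: "'a::ab_group_add \<Rightarrow> ('a \<Rightarrow> real) \<Rightarrow> bool" where
  "periodic a f \<longleftrightarrow> diff_op a f = (\<lambda>x. 0)"

text \<open>The intersection of the cyclic subgroups generated by the elements of \<open>B\<close>;
  the subgroup generated by a set \<open>S\<close> is \<open>group_closure S\<close>. It is only meaningful
  for nonempty \<open>B\<close>: for \<open>B = {}\<close> the intersection is \<open>UNIV\<close>.\<close>

definition bracket :: "'a::ab_group_add set \<Rightarrow> 'a set" where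
  "bracket B = (\<Inter>c\<in>B. group_closure {c})"

end

theory Submission
  imports Defs
begin

text \<open>Call two elements commensurable if they have a common nonzero multiple, and split
  \<open>S = {a\<^sub>1, \<dots>, a\<^sub>n}\<close> into a commensurability class \<open>C\<close> and its complement \<open>R\<close>. The elements of
  \<open>C\<close> have a common multiple \<open>c\<close>, and using \<open>C\<close> as a single block or as a set of singletons
  shows that both \<open>\<Delta>\<^sub>c f\<close> and the iterated difference of \<open>f\<close> over \<open>C\<close> satisfy the condition
  for \<open>R\<close>; by induction both are sums of \<open>R\<close>-periodic functions. As \<open>c\<close> is independent of
  every element of \<open>R\<close>, the equation \<open>\<Delta>\<^sub>c h = \<Delta>\<^sub>c f\<close> has a solution \<open>h\<close> of the same kind, and
  \<open>f - h\<close> is \<open>c\<close>-periodic. For a \<open>c\<close>-periodic function, averaging over the finitely many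
  shifts by multiples of \<open>a\<close> modulo \<open>c\<close> splits off an \<open>a\<close>-periodic part for each \<open>a \<in> C\<close>; what
  remains is a combination of shifts of the iterated difference over \<open>C\<close>, hence again a
  sum of \<open>R\<close>-periodic functions.\<close>

section \<open>Integer multiples and cyclic subgroups\<close>

text \<open>\<open>nat\<close> truncates negative numbers to \<open>0\<close>, so at most one of the
  two sums is nonempty.\<close>

definition imul :: "int \<Rightarrow> 'a::ab_group_add \<Rightarrow> 'a" where
  "imul k x = (\<Sum>i<nat k. x) - (\<Sum>i<nat (- k). x)"

lemma imul_0 [simp]: "imul 0 x = 0"
  by (simp add: imul_def)

lemma imul_1: "imul 1 x = x"
  by (simp add: imul_def)

lemma imul_succ: "imul (k + 1) x = imul k x + x"
proof (cases "k \<ge> 0")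
  case True
  then have "nat (k + 1) = Suc (nat k)" by simp
  with True show ?thesis by (simp add: imul_def)
next
  case False
  then have "nat (- k) = Suc (nat (- (k + 1)))" by simp
  with False show ?thesis by (simp add: imul_def)
qed

lemma imul_pred: "imul (k - 1) x = imul k x - x"
  using imul_succ [of "k - 1" x] by simp

lemma imul_add_left: "imul (k + l) x = imul k x + imul l x"
proof (induction l rule: int_induct [where k = 0])
  case (step1 i)
  then show ?case using imul_succ [of "k + i" x] by (simp add: imul_succ add.assoc)
next
  case (step2 i)
  then show ?case using imul_pred [of "k + i" x] by (simp add: imul_pred add_diff_eq)
qed simp

lemma imul_add_right: "imul k (x + y) = imul k x + imul k y"
  by (induction k rule: int_induct [where k = 0]) (simp_all add: imul_succ imul_pred)

lemma imul_imul: "imul k (imul l x) = imul (k * l) x"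
proof (induction k rule: int_induct [where k = 0])
  case (step1 i)
  then show ?case by (simp add: imul_succ imul_add_left imul_1 distrib_right)
next
  case (step2 i)
  then show ?case
    using imul_add_left [of "(i - 1) * l" l x] by (simp add: imul_pred algebra_simps)
qed simp

interpretation imul: module imul
  by standard (simp_all add: imul_add_left imul_add_right imul_imul imul_1)

lemma group_closure_singleton: "group_closure {a} = range (\<lambda>k. imul k a)"
proof (intro equalityI subsetI)
  fix x assume "x \<in> group_closure {a}"
  then show "x \<in> range (\<lambda>k. imul k a)"
  proof induction
    case (base s)
    then show ?case
      using rangeI [of "\<lambda>k. imul k a" 0] rangeI [of "\<lambda>k. imul k a" 1] by auto
  next
    case (diff s t)
    then show ?case by (auto simp flip: imul.scale_left_diff_distrib)
  qed
next
  fix x assume "x \<in> range (\<lambda>k. imul k a)"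
  then obtain k where x: "x = imul k a" by blast
  have "imul k a \<in> group_closure {a}"
    by (induction k rule: int_induct [where k = 0])
      (auto simp: imul_succ imul_pred intro: group_closure_add group_closure.intros)
  with x show "x \<in> group_closure {a}" by simp
qed

section \<open>Difference operators and periods\<close>

lemma periodic_iff: "periodic a f \<longleftrightarrow> (\<forall>x. f (x + a) = f x)"
  by (simp add: periodic_def diff_op_def fun_eq_iff)

lemma periodic_imul:
  assumes "periodic a f"
  shows "f (x + imul k a) = f x"
proof (induction k rule: int_induct [where k = 0])
  case (step1 i)
  then show ?case
    using assms by (simp add: periodic_iff imul_succ flip: add.assoc)
next
  case (step2 i)
  have "f (x + imul (i - 1) a) = f (x + imul (i - 1) a + a)"
    using assms by (simp add: periodic_iff)
  also have "x + imul (i - 1) a + a = x + imul i a"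
    by (simp add: imul_pred)
  finally show ?case using step2 by simp
qed simp

lemma periodic_group_closure:
  assumes "periodic a f" "b \<in> group_closure {a}"
  shows "periodic b f"
  using assms periodic_imul [OF assms(1)] by (auto simp: periodic_iff group_closure_singleton)

lemma diff_op_commute: "diff_op a (diff_op b f) = diff_op b (diff_op a f)"
  by (simp add: diff_op_def fun_eq_iff algebra_simps)

lemma periodic_diff_op: "periodic c f \<Longrightarrow> periodic c (diff_op a f)"
  unfolding periodic_iff diff_op_def by (metis add.assoc add.commute)

lemma diff_op_zero [simp]: "diff_op a (\<lambda>x. 0) = (\<lambda>x. 0)"
  by (simp add: diff_op_def)

lemma foldr_diff_op_zero [simp]: "foldr diff_op bs (\<lambda>x. 0) = (\<lambda>x. 0)"
  by (induction bs) simp_all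

lemma foldr_diff_op_commute: "foldr diff_op bs (diff_op a f) = diff_op a (foldr diff_op bs f)"
  by (induction bs) (simp_all add: diff_op_commute)

lemma foldr_diff_op_diff:
  "foldr diff_op bs (\<lambda>x. f x - g x) = (\<lambda>x. foldr diff_op bs f x - foldr diff_op bs g x)"
  by (induction bs) (simp_all add: diff_op_def fun_eq_iff)

lemma foldr_diff_op_sum:
  "foldr diff_op bs (\<lambda>x. \<Sum>j\<in>J. g j x) = (\<lambda>x. \<Sum>j\<in>J. foldr diff_op bs (g j) x)"
  by (induction bs) (simp_all add: diff_op_def fun_eq_iff sum_subtractf)

text \<open>The operators commute, so \<open>diff_op b\<close> can be moved innermost, where it
  kills \<open>f\<close>.\<close>

lemma foldr_diff_op_periodic:
  assumes "b \<in> set bs" "periodic b f"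
  shows "foldr diff_op bs f = (\<lambda>x. 0)"
  using assms
proof (induction bs)
  case (Cons c bs)
  show ?case
  proof (cases "b = c")
    case True
    have "foldr diff_op (c # bs) f = foldr diff_op bs (diff_op c f)"
      by (simp add: foldr_diff_op_commute)
    with True Cons.prems show ?thesis by (simp add: periodic_def)
  qed (use Cons in auto)
qed simp

section \<open>Sums of periodic functions\<close>

text \<open>The number of summands is left open and periods may repeat, so that closure properties
  follow by rule induction; \<open>decomposable_family\<close> recovers one summand per
  index.\<close>

inductive decomposable :: "'a::ab_group_add set \<Rightarrow> ('a \<Rightarrow> real) \<Rightarrow> bool" for S where
  zero: "decomposable S (\<lambda>x. 0)"
| add: "s \<in> S \<Longrightarrow> periodic s g \<Longrightarrow> decomposable S f \<Longrightarrow> decomposable S (\<lambda>x. g x + f x)"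

lemma decomposable_mono:
  assumes "decomposable S f" "S \<subseteq> T"
  shows "decomposable T f"
  using assms(1) by induction (use assms(2) in \<open>auto intro: decomposable.intros\<close>)

lemma decomposable_add:
  assumes "decomposable S f" "decomposable S h"
  shows "decomposable S (\<lambda>x. f x + h x)"
  using assms(1)
proof induction
  case (add s g f)
  from decomposable.add [OF add.hyps(1,2) add.IH] show ?case by (simp add: add.assoc)
qed (simp add: assms(2))

lemma decomposable_scale:
  assumes "decomposable S f"
  shows "decomposable S (\<lambda>x. r * f x)"
  using assms
proof induction
  case (add s g f)
  have "periodic s (\<lambda>x. r * g x)" using add.hyps(2) by (simp add: periodic_iff)
  from decomposable.add [OF add.hyps(1) this add.IH] show ?case by (simp add: distrib_left)
qed (simp add: decomposable.zero)

lemma decomposable_diff: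
  "decomposable S f \<Longrightarrow> decomposable S h \<Longrightarrow> decomposable S (\<lambda>x. f x - h x)"
  using decomposable_add [of S f "\<lambda>x. (- 1) * h x"] decomposable_scale [of S h "- 1"] by simp

lemma decomposable_sum:
  "(\<And>i. i \<in> I \<Longrightarrow> decomposable S (f i)) \<Longrightarrow> decomposable S (\<lambda>x. \<Sum>i\<in>I. f i x)"
  by (induction I rule: infinite_finite_induct)
    (auto intro: decomposable.zero decomposable_add)

lemma decomposable_shift:
  assumes "decomposable S f"
  shows "decomposable S (\<lambda>x. f (x + t))"
  using assms
proof induction
  case (add s g f)
  have "periodic s (\<lambda>x. g (x + t))" using add.hyps(2)
    unfolding periodic_iff by (metis add.assoc add.commute)
  from decomposable.add [OF add.hyps(1) this add.IH] show ?case .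
qed (simp add: decomposable.zero)

lemma decomposable_foldr_diff_op:
  assumes "decomposable S f"
  shows "decomposable S (foldr diff_op bs f)"
  by (induction bs)
    (simp_all add: assms diff_op_def decomposable_diff decomposable_shift)

text \<open>Repeated periods are merged: each summand is absorbed into the term of one chosen index
  with its period.\<close>

lemma decomposable_family:
  assumes "finite J" "decomposable (a ` J) f"
  shows "\<exists>g. (\<forall>j\<in>J. periodic (a j) (g j)) \<and> f = (\<lambda>x. \<Sum>j\<in>J. g j x)"
  using assms(2)
proof induction
  case zero
  show ?case by (intro exI [of _ "\<lambda>j x. 0"]) (simp add: periodic_iff)
next
  case (add s h f)
  then obtain g i where g: "\<forall>j\<in>J. periodic (a j) (g j)" "f = (\<lambda>x. \<Sum>j\<in>J. g j x)"
    and i: "i \<in> J" "s = a i" by blast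
  show ?case
  proof (intro exI conjI)
    show "\<forall>j\<in>J. periodic (a j) ((g(i := \<lambda>x. h x + g i x)) j)"
      using g(1) i add.hyps(2) by (auto simp: periodic_iff)
    show "(\<lambda>x. h x + f x) = (\<lambda>x. \<Sum>j\<in>J. (g(i := \<lambda>x. h x + g i x)) j x)"
      using i(1) \<open>finite J\<close> by (simp add: g(2) sum.remove fun_eq_iff)
  qed
qed

text \<open>The \<open>a\<close>-periodic part of \<open>f\<close> is its average over the shifts by \<open>0, a, \<dots>, (p - 1) a\<close>;
  the remainder is a combination of shifts of \<open>diff_op a f\<close>.\<close>

lemma decomposable_insert_average:
  fixes p :: int
  assumes "p \<noteq> 0" and per: "periodic (imul p a) f" and dec: "decomposable T (diff_op a f)"
  shows "decomposable (insert a T) f"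
proof -
  define n where "n = nat \<bar>p\<bar>"
  have n: "n > 0" using \<open>p \<noteq> 0\<close> by (simp add: n_def)
  have per_n: "f (x + imul (int n) a) = f x" for x
    using periodic_imul [OF per, of x 1] periodic_imul [OF per, of x "- 1"]
    by (cases "p \<ge> 0") (simp_all add: n_def)
  define m where "m = (\<lambda>x. (\<Sum>i<n. f (x + imul (int i) a)) / n)"
  have "m (x + a) = m x" for x
  proof -
    have "(\<Sum>i<n. f (x + a + imul (int i) a)) = (\<Sum>i<n. f (x + imul (int (Suc i)) a))"
      by (simp add: imul.scale_left_distrib algebra_simps)
    also have "\<dots> = (\<Sum>i<Suc n. f (x + imul (int i) a)) - f x"
      by (subst sum.lessThan_Suc_shift) simp
    also have "\<dots> = (\<Sum>i<n. f (x + imul (int i) a))"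
      by (simp add: per_n)
    finally show ?thesis by (simp add: m_def)
  qed
  then have m: "periodic a m" by (simp add: periodic_iff)
  define r where
    "r = (\<lambda>x. (- 1 / n) * (\<Sum>i<n. \<Sum>j<i. diff_op a f (x + imul (int j) a)))"
  have "decomposable T r"
    unfolding r_def
    by (intro decomposable_scale decomposable_sum decomposable_shift dec)
  then have "decomposable (insert a T) (\<lambda>x. m x + r x)"
    by (intro decomposable.add [of a]) (auto intro: decomposable_mono m)
  moreover have "m x + r x = f x" for x
  proof -
    \<comment> \<open>Telescoping: \<open>r x\<close> is the average of the differences
      \<open>f x - f (x + imul (int i) a)\<close>, which is \<open>f x - m x\<close>.\<close>
    have "(\<Sum>j<i. diff_op a f (x + imul (int j) a)) = f (x + imul (int i) a) - f x" for i :: nat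
      by (induction i) (simp_all add: diff_op_def imul.scale_left_distrib algebra_simps)
    then have "r x = (- 1 / n) * (\<Sum>i<n. f (x + imul (int i) a) - f x)"
      unfolding r_def by presburger
    also have "\<dots> = - m x + f x"
      using n by (simp add: m_def sum_subtractf field_simps)
    finally have "r x = - m x + f x" .
    then show ?thesis by simp
  qed
  ultimately show ?thesis by simp
qed

text \<open>One direction is peeled off at a time: \<open>diff_op a f\<close> inherits the period
  \<open>c\<close>, and by commutation its differences along \<open>as\<close> are those of
  \<open>f\<close> along \<open>a # as\<close>. Averaging over \<open>a\<close> then returns from
  \<open>diff_op a f\<close> to \<open>f\<close>.\<close>

lemma decomposable_average:
  assumes "\<forall>a\<in>set as. \<exists>p. p \<noteq> 0 \<and> imul p a = c"
    and "periodic c f" "decomposable T (foldr diff_op as f)"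
  shows "decomposable (set as \<union> T) f"
  using assms
proof (induction as arbitrary: f)
  case (Cons a as)
  have "decomposable (set as \<union> T) (diff_op a f)"
    using Cons.prems by (intro Cons.IH periodic_diff_op) (auto simp: foldr_diff_op_commute)
  with Cons.prems(1,2) show ?case
    by (auto intro: decomposable_insert_average)
qed simp

section \<open>Solving the difference equation\<close>

lemma exists_antidifference:
  fixes v :: "int \<Rightarrow> real"
  shows "\<exists>F. \<forall>i. F (i + 1) - F i = v i"
proof (intro exI allI)
  fix i :: int
  \<comment> \<open>Normalised by value \<open>0\<close> at \<open>0\<close>; for negative arguments
    the values of \<open>v\<close> at \<open>-1\<close>, \<open>-2\<close>, ... are
    subtracted.\<close>
  let ?F = "\<lambda>i. (\<Sum>t<nat i. v (int t)) - (\<Sum>t<nat (- i). v (- 1 - int t))"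
  show "?F (i + 1) - ?F i = v i"
  proof (cases "i \<ge> 0")
    case True
    then have "nat (i + 1) = Suc (nat i)" by simp
    with True show ?thesis by simp
  next
    case False
    then have "nat (- i) = Suc (nat (- (i + 1)))" by simp
    with False show ?thesis by simp
  qed
qed

text \<open>Sum \<open>u\<close> along the direction \<open>c\<close>, starting from a transversal \<open>r\<close> of the subgroup
  generated by \<open>a\<close> and \<open>c\<close>; independence makes the coordinate along \<open>c\<close> well defined.\<close>

lemma periodic_solution:
  fixes a c :: "'a::ab_group_add"
  assumes indep: "\<And>m k. imul m c = imul k a \<Longrightarrow> m = 0" and u: "periodic a u"
  shows "\<exists>h. periodic a h \<and> diff_op c h = u"
proof -
  \<comment> \<open>Congruence modulo the subgroup generated by \<open>a\<close> and
    \<open>c\<close>.\<close>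
  define R where "R x y \<longleftrightarrow> (\<exists>i k. x = y + imul i c + imul k a)" for x y
  have R_refl: "R x x" for x
    unfolding R_def by (intro exI [of _ 0]) simp
  have R_sym: "R y x" if "R x y" for x y
  proof -
    from that obtain i k where "x = y + imul i c + imul k a" by (auto simp: R_def)
    then have "y = x + imul (- i) c + imul (- k) a" by (simp add: algebra_simps)
    then show ?thesis unfolding R_def by blast
  qed
  have R_trans: "R x z" if "R x y" "R y z" for x y z
  proof -
    from that obtain i k i' k' where "x = y + imul i c + imul k a" "y = z + imul i' c + imul k' a"
      by (auto simp: R_def)
    then have "x = z + imul (i + i') c + imul (k + k') a" by (simp add: algebra_simps)
    then show ?thesis unfolding R_def by blast
  qed
  define r where "r x = (SOME y. R x y)" for x
  have R_r: "R x (r x)" for x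
    unfolding r_def by (rule someI [of _ x]) (rule R_refl)
  have r_eq: "r x = r y" if "R x y" for x y
  proof -
    have "R x = R y" using that R_sym R_trans by blast
    then show ?thesis by (simp add: r_def)
  qed
  have "R (x + c) x" for x
    unfolding R_def by (intro exI [of _ 1] exI [of _ 0]) simp
  then have r_c: "r (x + c) = r x" for x by (rule r_eq)
  have "R (x + a) x" for x
    unfolding R_def by (intro exI [of _ 0] exI [of _ 1]) simp
  then have r_a: "r (x + a) = r x" for x by (rule r_eq)
  \<comment> \<open>Only the coordinate \<open>i\<close> along \<open>c\<close> is recorded;
    \<open>k\<close> stays existential because it is not unique when \<open>a\<close> has finite
    order.\<close>
  define P where "P x i \<longleftrightarrow> (\<exists>k. x = r x + imul i c + imul k a)" for x i
  define ix where "ix x = (THE i. P x i)" for x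
  have unique: "i = j" if ij: "P x i" "P x j" for x i j
  proof -
    obtain k l where k: "x = r x + imul i c + imul k a" and l: "x = r x + imul j c + imul l a"
      using ij unfolding P_def by blast
    have "imul (i - j) c = imul (l - k) a"
      using trans [OF k [symmetric] l] by (simp add: algebra_simps)
    from indep [OF this] show ?thesis by simp
  qed
  have P_ix: "P x (ix x)" for x
  proof -
    obtain i where "P x i" using R_r [of x] unfolding R_def P_def by blast
    then show ?thesis unfolding ix_def by (rule theI) (rule unique [OF _ \<open>P x i\<close>])
  qed
  have ix_c: "ix (x + c) = ix x + 1" for x
  proof -
    obtain k where k: "x = r x + imul (ix x) c + imul k a"
      using P_ix [of x] unfolding P_def by blast
    have "x + c = r x + imul (ix x) c + imul k a + c" using k by simp
    also have "\<dots> = r (x + c) + imul (ix x + 1) c + imul k a"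
      unfolding r_c by (simp add: imul.scale_left_distrib algebra_simps)
    finally have "P (x + c) (ix x + 1)" unfolding P_def by blast
    from unique [OF P_ix this] show ?thesis .
  qed
  have ix_a: "ix (x + a) = ix x" for x
  proof -
    obtain k where k: "x = r x + imul (ix x) c + imul k a"
      using P_ix [of x] unfolding P_def by blast
    have "x + a = r x + imul (ix x) c + imul k a + a" using k by simp
    also have "\<dots> = r (x + a) + imul (ix x) c + imul (k + 1) a"
      unfolding r_a by (simp add: imul.scale_left_distrib algebra_simps)
    finally have "P (x + a) (ix x)" unfolding P_def by blast
    from unique [OF P_ix this] show ?thesis .
  qed
  obtain F where F: "\<And>y i. F y (i + 1) - F y i = u (y + imul i c)"
    using exists_antidifference [of "\<lambda>i. u (y + imul i c)" for y] by metis
  \<comment> \<open>A shift by \<open>a\<close> changes neither \<open>r x\<close> nor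
    \<open>ix x\<close>; a shift by \<open>c\<close> only raises \<open>ix x\<close> by one.\<close>
  define h where "h x = F (r x) (ix x)" for x
  have "periodic a h" by (simp add: periodic_iff h_def r_a ix_a)
  moreover have "diff_op c h x = u x" for x
  proof -
    obtain k where k: "x = r x + imul (ix x) c + imul k a" using P_ix [of x] unfolding P_def by blast
    have "diff_op c h x = u (r x + imul (ix x) c)"
      by (simp add: diff_op_def h_def r_c ix_c F)
    \<comment> \<open>The forgotten displacement along \<open>a\<close> is harmless since
      \<open>u\<close> is \<open>a\<close>-periodic.\<close>
    also have "\<dots> = u (r x + imul (ix x) c + imul k a)"
      by (simp add: periodic_imul [OF u])
    also have "\<dots> = u x" using k by simp
    finally show ?thesis .
  qed
  ultimately show ?thesis by blast
qed

lemma decomposable_solution: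
  assumes indep: "\<And>a m k. a \<in> T \<Longrightarrow> imul m c = imul k a \<Longrightarrow> m = 0"
    and "decomposable T u"
  shows "\<exists>h. decomposable T h \<and> diff_op c h = u"
  using assms(2)
proof induction
  case zero
  show ?case by (intro exI [of _ "\<lambda>x. 0"]) (simp add: decomposable.zero)
next
  case (add s g f)
  from add.IH obtain h where h: "decomposable T h" "diff_op c h = f" by blast
  obtain h' where h': "periodic s h'" "diff_op c h' = g"
    using periodic_solution [of c s g, OF _ add.hyps(2)] indep [OF add.hyps(1)] by blast
  have "diff_op c (\<lambda>x. h' x + h x) = (\<lambda>x. g x + f x)"
    using h(2) h'(2) by (auto simp: diff_op_def)
  with decomposable.add [OF add.hyps(1) h'(1) h(1)] show ?case by blast
qed

section \<open>Partitions with chosen bracket elements\<close>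

text \<open>Packages the quantifiers of the theorem's right-hand side; listing the blocks matches
  them with their elements by position.\<close>

definition bracket_system :: "'a::ab_group_add list \<Rightarrow> 'a set \<Rightarrow> bool" where
  "bracket_system bs S \<longleftrightarrow> (\<exists>Bs. distinct Bs \<and> partition_on S (set Bs) \<and>
     length bs = length Bs \<and> (\<forall>j<length Bs. bs ! j \<in> bracket (Bs ! j)))"

lemma bracket_system_alt:
  "bracket_system bs S \<longleftrightarrow> (\<exists>Bs. distinct Bs \<and> partition_on S (set Bs) \<and>
     list_all2 (\<lambda>b B. b \<in> bracket B) bs Bs)"
  unfolding bracket_system_def list_all2_conv_all_nth by metis

text \<open>Appending lists composes iterated differences, so the condition for a disjoint union
  passes to one part after a system of the other part is applied to \<open>f\<close>.\<close>

lemma bracket_system_append: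
  assumes "bracket_system bs S" "bracket_system bs' S'" "S \<inter> S' = {}"
  shows "bracket_system (bs @ bs') (S \<union> S')"
proof -
  obtain Bs Bs' where B: "distinct Bs" "partition_on S (set Bs)" "list_all2 (\<lambda>b B. b \<in> bracket B) bs Bs"
    and B': "distinct Bs'" "partition_on S' (set Bs')" "list_all2 (\<lambda>b B. b \<in> bracket B) bs' Bs'"
    using assms(1,2) unfolding bracket_system_alt by blast
  have disj: "X \<inter> Y = {}" if "X \<in> set Bs" "Y \<in> set Bs'" for X Y
    using that assms(3) partition_onD1 [OF B(2)] partition_onD1 [OF B'(2)] by blast
  \<comment> \<open>A shared block would be disjoint from itself, hence empty.\<close>
  have "set Bs \<inter> set Bs' = {}"
    using disj partition_onD3 [OF B(2)] by fastforce
  then have "distinct (Bs @ Bs')" using B(1) B'(1) by simp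
  moreover have "partition_on (S \<union> S') (set (Bs @ Bs'))"
  proof (rule partition_onI)
    show "\<Union> (set (Bs @ Bs')) = S \<union> S'"
      using partition_onD1 [OF B(2)] partition_onD1 [OF B'(2)] by simp
    show "{} \<notin> set (Bs @ Bs')"
      using partition_onD3 [OF B(2)] partition_onD3 [OF B'(2)] by simp
    show "disjnt p q" if "p \<in> set (Bs @ Bs')" "q \<in> set (Bs @ Bs')" "p \<noteq> q" for p q
      using that disj partition_onD2 [OF B(2)] partition_onD2 [OF B'(2)]
      unfolding disjnt_def disjoint_def set_append Un_iff by (metis Int_commute)
  qed
  moreover have "list_all2 (\<lambda>b B. b \<in> bracket B) (bs @ bs') (Bs @ Bs')"
    using B(3) B'(3) by (rule list_all2_appendI)
  ultimately show ?thesis unfolding bracket_system_alt by blast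
qed

lemma bracket_system_singletons:
  assumes "distinct as"
  shows "bracket_system as (set as)"
  unfolding bracket_system_def
proof (intro exI conjI)
  show "distinct (map (\<lambda>a. {a}) as)" using assms by (simp add: distinct_map)
  show "partition_on (set as) (set (map (\<lambda>a. {a}) as))"
    using partition_on_singletons [of "set as"] by simp
qed (auto simp: bracket_def intro: group_closure.base)

lemma bracket_system_block:
  assumes "C \<noteq> {}" "c \<in> bracket C"
  shows "bracket_system [c] C"
  unfolding bracket_system_def
  by (intro exI [of _ "[C]"]) (simp add: assms partition_on_space)

section \<open>Commensurability\<close>

text \<open>Only the coefficients must be nonzero, not the common multiple, so any two torsion
  elements are commensurable.\<close>

definition commensurable :: "'a::ab_group_add \<Rightarrow> 'a \<Rightarrow> bool" where
  "commensurable x y \<longleftrightarrow> (\<exists>p q. p \<noteq> 0 \<and> q \<noteq> 0 \<and> imul p x = imul q y)"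

lemma commensurable_refl: "commensurable x x"
  unfolding commensurable_def by (intro exI [of _ 1]) simp

text \<open>The coefficient of \<open>x\<close> is carried through the induction to link a new
  \<open>y\<close> to the old \<open>c\<close>: if \<open>c = p x\<close> and
  \<open>q x = r y\<close>, then \<open>q c = (p r) y\<close>.\<close>

lemma common_multiple:
  assumes "finite C" "\<forall>a\<in>C. commensurable x a"
  shows "\<exists>c. (\<exists>p. p \<noteq> 0 \<and> imul p x = c) \<and> (\<forall>a\<in>C. \<exists>p. p \<noteq> 0 \<and> imul p a = c)"
  using assms
proof (induction C rule: finite_induct)
  case empty
  show ?case by (auto intro: exI [of _ 1])
next
  case (insert y C)
  then obtain c p where c: "p \<noteq> 0" "imul p x = c" "\<forall>a\<in>C. \<exists>p. p \<noteq> 0 \<and> imul p a = c"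
    by auto
  obtain q r where qr: "q \<noteq> 0" "r \<noteq> 0" "imul q x = imul r y"
    using insert.prems unfolding commensurable_def by auto
  have mult: "\<exists>p. p \<noteq> 0 \<and> imul p a = imul q c" if "\<exists>p. p \<noteq> 0 \<and> imul p a = c" for a
  proof -
    from that obtain p' where "p' \<noteq> 0" "imul p' a = c" by blast
    then show ?thesis
      using qr(1) by (intro exI [of _ "q * p'"]) (auto simp flip: imul_imul)
  qed
  have "imul (p * r) y = imul p (imul q x)"
    by (simp add: qr(3) imul_imul)
  also have "\<dots> = imul q c"
    by (simp add: c(2) [symmetric] imul_imul mult.commute)
  finally have "\<exists>p. p \<noteq> 0 \<and> imul p y = imul q c"
    using c(1) qr(2) by (intro exI [of _ "p * r"]) simp
  with mult c show ?case by (intro exI [of _ "imul q c"]) auto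
qed

text \<open>A torsion class gets \<open>c = 0\<close>, for which \<open>diff_op c\<close> vanishes identically.\<close>

lemma commensurability_class_bracket:
  assumes "finite S" and C: "C = {a \<in> S. commensurable x a}"
  shows "\<exists>c. c \<in> bracket C \<and> (\<forall>a\<in>C. \<exists>p. p \<noteq> 0 \<and> imul p a = c) \<and>
    (c = 0 \<or> (\<forall>a m k. a \<in> S - C \<longrightarrow> imul m c = imul k a \<longrightarrow> m = 0))"
proof -
  have "finite C" "\<forall>a\<in>C. commensurable x a" using assms by simp_all
  from common_multiple [OF this] obtain c p
    where c: "p \<noteq> 0" "imul p x = c" "\<forall>a\<in>C. \<exists>p. p \<noteq> 0 \<and> imul p a = c"
    by blast
  have bracketI: "d \<in> bracket C" if "\<forall>a\<in>C. \<exists>p. p \<noteq> 0 \<and> imul p a = d" for d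
    unfolding bracket_def
  proof
    fix a assume "a \<in> C"
    with that obtain p where "imul p a = d" by blast
    then show "d \<in> group_closure {a}" by (auto simp: group_closure_singleton)
  qed
  show ?thesis
  proof (cases "\<exists>N. N \<noteq> 0 \<and> imul N c = 0")
    case True
    then obtain N where N: "N \<noteq> 0" "imul N c = 0" by blast
    \<comment> \<open>With \<open>c\<close> torsion, \<open>0\<close> is itself an admissible common
      multiple and replaces \<open>c\<close>.\<close>
    have "\<forall>a\<in>C. \<exists>p. p \<noteq> 0 \<and> imul p a = 0"
    proof
      fix a assume "a \<in> C"
      with c(3) obtain p' where "p' \<noteq> 0" "imul p' a = c" by blast
      with N show "\<exists>p. p \<noteq> 0 \<and> imul p a = 0"
        by (intro exI [of _ "N * p'"]) (auto simp flip: imul_imul)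
    qed
    with bracketI show ?thesis by blast
  next
    case False
    \<comment> \<open>A nontrivial relation between \<open>c\<close> and \<open>a\<close> would make
      \<open>a\<close> commensurable with \<open>x\<close>, hence a member of
      \<open>C\<close>.\<close>
    have "m = 0" if a: "a \<in> S - C" and eq: "imul m c = imul k a" for a m k
    proof (rule ccontr)
      assume "m \<noteq> 0"
      with False eq have "k \<noteq> 0" by auto
      moreover have "imul (m * p) x = imul k a"
        using eq by (simp add: c(2) flip: imul_imul)
      ultimately have "commensurable x a"
        using \<open>m \<noteq> 0\<close> c(1) unfolding commensurable_def by (metis mult_eq_0_iff)
      with a C show False by simp
    qed
    with c(3) bracketI show ?thesis by blast
  qed
qed

lemma decomposable_if_annihilated:
  assumes "finite S" "\<And>bs. bracket_system bs S \<Longrightarrow> foldr diff_op bs f = (\<lambda>x. 0)"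
  shows "decomposable S f"
  using assms
proof (induction S arbitrary: f rule: finite_psubset_induct)
  case (psubset S)
  show ?case
  proof (cases "S = {}")
    case True
    \<comment> \<open>The empty partition contributes no operator, so the condition itself says
      \<open>f = 0\<close>.\<close>
    have "bracket_system [] S"
      unfolding bracket_system_def True by (intro exI [of _ "[]"]) (simp add: partition_on_empty)
    from psubset.prems [OF this] show ?thesis by (simp add: decomposable.zero)
  next
    case False
    then obtain x where x: "x \<in> S" by blast
    define C where "C = {a \<in> S. commensurable x a}"
    define R where "R = S - C"
    have "x \<in> C" using x by (simp add: C_def commensurable_refl)
    then have "R \<subset> S" using x by (auto simp: R_def)
    have S: "R \<union> C = S" "R \<inter> C = {}" by (auto simp: R_def C_def)
    obtain c where c: "c \<in> bracket C" "\<forall>a\<in>C. \<exists>p. p \<noteq> 0 \<and> imul p a = c"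
      "c = 0 \<or> (\<forall>a m k. a \<in> R \<longrightarrow> imul m c = imul k a \<longrightarrow> m = 0)"
      using commensurability_class_bracket [OF psubset.hyps C_def] unfolding R_def by blast
    obtain as where as: "set as = C" "distinct as"
      using finite_distinct_list [of C] psubset.hyps by (auto simp: C_def)
    \<comment> \<open>The induction hypothesis is applied to the difference of \<open>f\<close>
      along \<open>cs\<close>, not to \<open>f\<close>.\<close>
    have dec: "decomposable R (foldr diff_op cs f)" if "bracket_system cs C" for cs
    proof (rule psubset.IH [OF \<open>R \<subset> S\<close>])
      fix bs assume "bracket_system bs R"
      from bracket_system_append [OF this that S(2)] psubset.prems S(1)
      show "foldr diff_op bs (foldr diff_op cs f) = (\<lambda>x. 0)" by fastforce
    qed
    have dec_c: "decomposable R (diff_op c f)"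
      using dec [OF bracket_system_block [OF _ c(1)]] \<open>x \<in> C\<close> by auto
    have dec_as: "decomposable R (foldr diff_op as f)"
      using dec bracket_system_singletons [OF as(2)] as(1) by simp
    \<comment> \<open>For \<open>c = 0\<close> both sides vanish and \<open>h = 0\<close>
      serves.\<close>
    obtain h where h: "decomposable R h" "diff_op c h = diff_op c f"
    proof (cases "c = 0")
      case True
      then show ?thesis using that [OF decomposable.zero] by (simp add: diff_op_def)
    next
      case False
      with c(3) decomposable_solution [OF _ dec_c] that show ?thesis by blast
    qed
    have "periodic c (\<lambda>x. f x - h x)"
      using fun_cong [OF h(2)] by (simp add: periodic_iff diff_op_def algebra_simps)
    moreover have "decomposable R (foldr diff_op as (\<lambda>x. f x - h x))"
      unfolding foldr_diff_op_diff
      by (intro decomposable_diff dec_as decomposable_foldr_diff_op h(1))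
    ultimately have "decomposable S (\<lambda>x. f x - h x)"
      using decomposable_average [of as c _ R] c(2) as(1) S(1) by (simp add: Un_commute)
    moreover have "decomposable S h"
      using h(1) \<open>R \<subset> S\<close> by (auto intro: decomposable_mono)
    ultimately have "decomposable S (\<lambda>x. (f x - h x) + h x)"
      by (rule decomposable_add)
    then show ?thesis by simp
  qed
qed

text \<open>The block containing \<open>a j\<close> carries a multiple of \<open>a j\<close>, hence
  a period of \<open>g j\<close>, so each summand is killed by one of the operators.\<close>

lemma annihilated_if_sum_periodic:
  assumes per: "\<And>j. j \<in> J \<Longrightarrow> periodic (a j) (g j)" and bs: "bracket_system bs (a ` J)"
  shows "foldr diff_op bs (\<lambda>x. \<Sum>j\<in>J. g j x) = (\<lambda>x. 0)"
proof -
  obtain Bs where Bs: "partition_on (a ` J) (set Bs)" "length bs = length Bs"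
    "\<forall>i<length Bs. bs ! i \<in> bracket (Bs ! i)"
    using bs unfolding bracket_system_def by blast
  have "foldr diff_op bs (g j) = (\<lambda>x. 0)" if "j \<in> J" for j
  proof -
    obtain i where i: "i < length Bs" "a j \<in> Bs ! i"
      using \<open>j \<in> J\<close> partition_onD1 [OF Bs(1)] by (metis UnionE imageI in_set_conv_nth)
    with Bs(3) have "bs ! i \<in> group_closure {a j}" by (auto simp: bracket_def)
    with per [OF that] have "periodic (bs ! i) (g j)" by (rule periodic_group_closure)
    with i(1) Bs(2) show ?thesis by (intro foldr_diff_op_periodic) auto
  qed
  then show ?thesis by (simp add: foldr_diff_op_sum)
qed

theorem corollary2p6:
  fixes n :: nat and a :: "nat \<Rightarrow> 'a::ab_group_add" and f :: "'a \<Rightarrow> real"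
  shows "(\<exists>g :: nat \<Rightarrow> 'a \<Rightarrow> real.
            (\<forall>j\<in>{1..n}. periodic (a j) (g j)) \<and> f = (\<lambda>x. \<Sum>j=1..n. g j x))
         \<longleftrightarrow>
         (\<forall>Bs :: 'a set list. \<forall>bs :: 'a list.
            distinct Bs \<and> partition_on (a ` {1..n}) (set Bs) \<and>
            length bs = length Bs \<and> (\<forall>j<length Bs. bs ! j \<in> bracket (Bs ! j))
            \<longrightarrow> foldr diff_op bs f = (\<lambda>x. 0))"
    (is "?dec \<longleftrightarrow> ?ann")
proof -
  have "?ann \<longleftrightarrow> (\<forall>bs. bracket_system bs (a ` {1..n}) \<longrightarrow> foldr diff_op bs f = (\<lambda>x. 0))"
    unfolding bracket_system_def by blast
  moreover have "?dec \<longleftrightarrow> \<dots>"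
  proof
    assume ?dec
    then show "\<forall>bs. bracket_system bs (a ` {1..n}) \<longrightarrow> foldr diff_op bs f = (\<lambda>x. 0)"
      using annihilated_if_sum_periodic [where J = "{1..n}" and a = a] by blast
  next
    assume "\<forall>bs. bracket_system bs (a ` {1..n}) \<longrightarrow> foldr diff_op bs f = (\<lambda>x. 0)"
    then have "decomposable (a ` {1..n}) f"
      by (intro decomposable_if_annihilated) auto
    then show ?dec by (intro decomposable_family) auto
  qed
  ultimately show ?thesis by blast
qed

end
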